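(* Let $n\ge 1$ and $j\ge 0$ be integers, and let $z_1,\dots,z_n$ be complex numbers with $|z_k|=1$ for all $k$. Then $$\max_{\nu=1,\ldots,n^2+j}\left|\sum_{k=1}^n z_k^\nu\right|\ \ge\ \sqrt{n+\frac{(1+j)(n-1)}{2(j+n^2)}}.$$
   Context: The index $\nu$ ranges over integers. *)

theory Defs
  imports "HOL-Analysis.Analysis"
begin

end

theory Submission
  imports Defs
begin

text \<open>
  Write \<open>s \<nu>\<close> for the power sum of the \<open>z k\<close>, put \<open>N = n^2 + j\<close>, and look at the function
  \<open>g \<nu> = \<bar>s \<nu>\<bar>^2 - n\<close> of an integer \<open>\<nu>\<close>. Expanding the square, \<open>g \<nu>\<close> is the \<open>\<nu>\<close>-th power sum of
  the \<open>n^2 - n\<close> unimodular quotients \<open>z k / z l\<close> with \<open>k \<noteq> l\<close>. Power sums of unimodular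
  numbers obey two inequalities on the \<open>(N + 1) \<times> (N + 1)\<close> Toeplitz matrix with entries
  \<open>g (i - j)\<close>: the sum of all entries is nonnegative (positivity of the Fejer kernel), and the
  sum of all squared entries is at least \<open>(n^2 - n) (N + 1)^2\<close> (a rank bound on the matrix).

  Suppose that \<open>\<bar>s \<nu>\<bar>^2 \<le> n + a\<close> for \<open>1 \<le> \<nu> \<le> N\<close>. Off the diagonal the entries lie between
  \<open>- n\<close> and \<open>a\<close>, whence \<open>(g - a) (g + n) \<le> 0\<close> there, while on the diagonal \<open>g = n^2 - n\<close>. The sum
  of \<open>(g - a) (g + n) = g^2 + (n - a) g - a n\<close> over the whole matrix is therefore at most
  \<open>(N + 1) (n^2 - n - a) n^2\<close>, and, when \<open>a \<le> n\<close>, the two inequalities bound it below by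
  \<open>(n^2 - n - a n) (N + 1)^2\<close>. Comparing the two yields
  \<open>(n - 1) (N + 1 - n^2) \<le> a (N + 1 - n)\<close>,
  and since \<open>N + 1 - n \<le> 2 N\<close> this gives \<open>a \<ge> (n - 1) (1 + j) / (2 N)\<close>, as claimed. When
  \<open>a > n\<close>, there is nothing to do, because the claimed lower bound for \<open>a\<close> is below \<open>n\<close>.
\<close>

section \<open>Toeplitz matrices of power sums\<close>

text \<open>
  For unimodular \<open>w p\<close> this is the power sum with exponent \<open>i - j\<close>. Splitting the exponent
  avoids negative powers and makes the entry visibly an inner product of two vectors.
\<close>

definition power_gram :: "('a \<Rightarrow> complex) \<Rightarrow> 'a set \<Rightarrow> nat \<Rightarrow> nat \<Rightarrow> complex" where
  "power_gram w P i j = (\<Sum>p\<in>P. w p ^ i * cnj (w p) ^ j)"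

lemma unimodular_mult_cnj: "cmod x = 1 \<Longrightarrow> x * cnj x = 1"
  by (metis complex_norm_square of_real_1 power_one)

lemma power_gram_diagonal:
  assumes "\<And>p. p \<in> P \<Longrightarrow> cmod (w p) = 1"
  shows "power_gram w P i i = of_nat (card P)"
proof -
  have "power_gram w P i i = (\<Sum>p\<in>P. 1)"
    unfolding power_gram_def
    by (intro sum.cong refl) (simp add: power_mult_distrib[symmetric] unimodular_mult_cnj assms)
  then show ?thesis by simp
qed

lemma cnj_power_gram: "cnj (power_gram w P i j) = power_gram w P j i"
  by (simp add: power_gram_def mult.commute)

lemma power_gram_eq_power_sum:
  assumes "\<And>p. p \<in> P \<Longrightarrow> cmod (w p) = 1" and "j \<le> i"
  shows "power_gram w P i j = (\<Sum>p\<in>P. w p ^ (i - j))"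
  unfolding power_gram_def
proof (intro sum.cong refl)
  fix p assume p: "p \<in> P"
  have "w p ^ i = w p ^ (i - j) * w p ^ j"
    using assms(2) by (simp add: power_add[symmetric])
  then have "w p ^ i * cnj (w p) ^ j = w p ^ (i - j) * (w p * cnj (w p)) ^ j"
    by (simp add: power_mult_distrib)
  then show "w p ^ i * cnj (w p) ^ j = w p ^ (i - j)"
    by (simp add: unimodular_mult_cnj assms(1) p)
qed

lemma norm_power_gram_off_diagonal:
  assumes "\<And>p. p \<in> P \<Longrightarrow> cmod (w p) = 1" and "i \<noteq> j" "i \<le> N" "j \<le> N"
  obtains \<nu> where "\<nu> \<in> {1..N}" "cmod (power_gram w P i j) = cmod (\<Sum>p\<in>P. w p ^ \<nu>)"
proof (cases "j \<le> i")
  case True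
  then have "i - j \<in> {1..N}" using assms by auto
  then show ?thesis
    using that power_gram_eq_power_sum[of P w j i] assms(1) True by metis
next
  case False
  then have "j - i \<in> {1..N}" using assms by auto
  moreover have "cmod (power_gram w P i j) = cmod (power_gram w P j i)"
    by (metis cnj_power_gram complex_mod_cnj)
  ultimately show ?thesis
    using that power_gram_eq_power_sum[of P w i j] assms(1) False by (metis nat_le_linear)
qed

text \<open>
  Squared moduli of power sums are again power sums, now of the pairwise quotients. This is used
  once to pass from \<open>s\<close> to \<open>g\<close> and a second time to estimate the squares of \<open>g\<close>.
\<close>

lemma norm_power_gram_square:
  assumes "finite P"
  shows "of_real ((cmod (power_gram w P i j))\<^sup>2)
    = power_gram (\<lambda>(p, q). w p * cnj (w q)) (P \<times> P) i j"
proof -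
  have "of_real ((cmod (power_gram w P i j))\<^sup>2) = power_gram w P i j * cnj (power_gram w P i j)"
    by (simp only: complex_norm_square)
  also have "\<dots> = (\<Sum>p\<in>P. \<Sum>q\<in>P. (w p ^ i * cnj (w p) ^ j) * (cnj (w q) ^ i * w q ^ j))"
    by (simp add: power_gram_def sum_product)
  also have "\<dots> = (\<Sum>p\<in>P. \<Sum>q\<in>P. (w p * cnj (w q)) ^ i * cnj (w p * cnj (w q)) ^ j)"
    by (simp add: power_mult_distrib mult_ac)
  also have "\<dots> = power_gram (\<lambda>(p, q). w p * cnj (w q)) (P \<times> P) i j"
    by (simp add: power_gram_def sum.cartesian_product case_prod_unfold)
  finally show ?thesis .
qed

text \<open>
  Each \<open>w p\<close> contributes a matrix of rank one, whose entries sum to a squared modulus: this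
  is the factorisation of the Fejer kernel.
\<close>

lemma sum_power_gram:
  "(\<Sum>i<L. \<Sum>j<L. power_gram w P i j) = of_real (\<Sum>p\<in>P. (cmod (\<Sum>i<L. w p ^ i))\<^sup>2)"
proof -
  have "(\<Sum>i<L. \<Sum>j<L. power_gram w P i j) = (\<Sum>i<L. \<Sum>p\<in>P. \<Sum>j<L. w p ^ i * cnj (w p) ^ j)"
    unfolding power_gram_def by (intro sum.cong refl sum.swap)
  also have "\<dots> = (\<Sum>p\<in>P. \<Sum>i<L. \<Sum>j<L. w p ^ i * cnj (w p) ^ j)"
    by (rule sum.swap)
  also have "\<dots> = (\<Sum>p\<in>P. (\<Sum>i<L. w p ^ i) * cnj (\<Sum>i<L. w p ^ i))"
    by (simp add: sum_product)
  also have "\<dots> = of_real (\<Sum>p\<in>P. (cmod (\<Sum>i<L. w p ^ i))\<^sup>2)"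
    by (simp only: complex_norm_square[symmetric] of_real_sum)
  finally show ?thesis .
qed

text \<open>
  By positivity of the Fejer kernel, the expansion into pairs \<open>(p, q)\<close> can be restricted to the
  pairs \<open>(p, p)\<close>, each of which contributes the kernel's value at 1. In terms of eigenvalues,
  this is the Cauchy-Schwarz inequality for a Hermitian matrix of rank at most \<open>card P\<close> and
  trace \<open>card P * L\<close>.
\<close>

lemma sum_norm_power_gram_square_ge:
  assumes "finite P" and "\<And>p. p \<in> P \<Longrightarrow> cmod (w p) = 1"
  shows "(\<Sum>i<L. \<Sum>j<L. (cmod (power_gram w P i j))\<^sup>2) \<ge> real (card P) * (real L)\<^sup>2"
proof -
  let ?F = "\<lambda>(p, q). (cmod (\<Sum>i<L. (w p * cnj (w q)) ^ i))\<^sup>2"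
  have "complex_of_real (\<Sum>i<L. \<Sum>j<L. (cmod (power_gram w P i j))\<^sup>2)
      = (\<Sum>i<L. \<Sum>j<L. power_gram (\<lambda>(p, q). w p * cnj (w q)) (P \<times> P) i j)"
    unfolding of_real_sum by (intro sum.cong refl norm_power_gram_square assms(1))
  also have "\<dots> = of_real (\<Sum>x\<in>P \<times> P. ?F x)"
    unfolding sum_power_gram by (simp add: case_prod_unfold)
  finally have eq: "(\<Sum>i<L. \<Sum>j<L. (cmod (power_gram w P i j))\<^sup>2) = (\<Sum>x\<in>P \<times> P. ?F x)"
    by (simp only: of_real_eq_iff)
  have "real (card P) * (real L)\<^sup>2 = (\<Sum>p\<in>P. ?F (p, p))"
    by (simp add: unimodular_mult_cnj assms(2))
  also have "\<dots> = (\<Sum>x\<in>(\<lambda>p. (p, p)) ` P. ?F x)"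
    by (subst sum.reindex) (auto simp: inj_on_def)
  also have "\<dots> \<le> (\<Sum>x\<in>P \<times> P. ?F x)"
    using assms(1) by (intro sum_mono2) auto
  finally show ?thesis using eq by simp
qed

section \<open>The deviation of the squared power sums from their mean\<close>

text \<open>
  The pairs \<open>(p, p)\<close> have quotient 1 and account for the constant \<open>card P\<close>. Without them the
  squared moduli still form a power sum, with as many terms as there are pairs of distinct indices;
  this smaller number of terms is what the rank bound sees.
\<close>

lemma norm_power_gram_square_minus_card:
  assumes "finite P" and "\<And>p. p \<in> P \<Longrightarrow> cmod (w p) = 1"
  shows "of_real ((cmod (power_gram w P i j))\<^sup>2 - real (card P))
    = power_gram (\<lambda>(p, q). w p * cnj (w q)) (P \<times> P - Id) i j"
proof -
  let ?h = "\<lambda>(p, q). (w p * cnj (w q)) ^ i * cnj (w p * cnj (w q)) ^ j"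
  have split: "P \<times> P = (P \<times> P - Id) \<union> (\<lambda>p. (p, p)) ` P"
    by auto
  have "(\<Sum>x\<in>P \<times> P. ?h x) = (\<Sum>x\<in>P \<times> P - Id. ?h x) + (\<Sum>x\<in>(\<lambda>p. (p, p)) ` P. ?h x)"
    by (subst split, rule sum.union_disjoint) (use assms(1) in auto)
  also have "(\<Sum>x\<in>(\<lambda>p. (p, p)) ` P. ?h x) = (\<Sum>p\<in>P. ?h (p, p))"
    by (subst sum.reindex) (auto simp: inj_on_def)
  also have "\<dots> = of_nat (card P)"
    by (simp add: unimodular_mult_cnj mult.commute[of "cnj _"] assms(2))
  finally show ?thesis
    using norm_power_gram_square[OF assms(1), of w i j]
    by (simp add: power_gram_def case_prod_unfold)
qed

lemma card_off_diagonal: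
  assumes "finite P"
  shows "real (card (P \<times> P - Id)) = (real (card P))\<^sup>2 - real (card P)"
proof -
  have split: "P \<times> P = (P \<times> P - Id) \<union> (\<lambda>p. (p, p)) ` P"
    by auto
  have "card (P \<times> P) = card (P \<times> P - Id) + card ((\<lambda>p. (p, p)) ` P)"
    by (subst split, rule card_Un_disjoint) (use assms in auto)
  also have "card ((\<lambda>p. (p, p)) ` P) = card P"
    by (rule card_image) (simp add: inj_on_def)
  finally have "real (card P * card P) = real (card (P \<times> P - Id)) + real (card P)"
    by (simp add: card_cartesian_product)
  then show ?thesis by (simp add: power2_eq_square)
qed

text \<open>
  With \<open>g\<close> the squared modulus minus \<open>m\<close>, the convexity of the square trades \<open>g^2\<close> for a linear
  function of \<open>g\<close>: off the diagonal \<open>- m \<le> g \<le> a\<close>, so that \<open>(g - a) (g + m) \<le> 0\<close>. The coefficient \<open>m - a\<close> of \<open>g\<close> must be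
  nonnegative for the lower bound on the sum of \<open>g\<close> to point in the right direction.
\<close>

lemma power_sum_square_bound:
  fixes w :: "'a \<Rightarrow> complex" and P :: "'a set" and a :: real
  defines "m \<equiv> real (card P)"
  assumes fin: "finite P" and ne: "P \<noteq> {}" and uni: "\<And>p. p \<in> P \<Longrightarrow> cmod (w p) = 1"
    and bound: "\<And>\<nu>. \<nu> \<in> {1..N} \<Longrightarrow> (cmod (\<Sum>p\<in>P. w p ^ \<nu>))\<^sup>2 \<le> m + a"
    and a: "a \<le> m"
  shows "(m - 1) * (real N + 1 - m\<^sup>2) \<le> a * (real N + 1 - m)"
proof -
  define L where "L = real N + 1"
  define g where "g i j = (cmod (power_gram w P i j))\<^sup>2 - m" for i j
  define quot where "quot = (\<lambda>(p, q). w p * cnj (w q))"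
  define D where "D = P \<times> P - Id"
  have g_gram: "of_real (g i j) = power_gram quot D i j" for i j
    unfolding g_def m_def quot_def D_def
    by (rule norm_power_gram_square_minus_card[OF fin uni])
  have m_pos: "m > 0"
    using fin ne by (simp add: m_def card_gt_0_iff)
  have L_pos: "L > 0" by (simp add: L_def)
  have L_eq: "L = real (Suc N)" by (simp add: L_def)
  have g_diag: "g i i = m\<^sup>2 - m" for i
    using power_gram_diagonal[where P = P and w = w and i = i] uni by (simp add: g_def m_def)
  have g_off: "(g i j - a) * (g i j + m) \<le> 0" if ij: "i \<noteq> j" "i \<le> N" "j \<le> N" for i j
  proof -
    obtain \<nu> where \<nu>: "\<nu> \<in> {1..N}" "cmod (power_gram w P i j) = cmod (\<Sum>p\<in>P. w p ^ \<nu>)"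
      by (rule norm_power_gram_off_diagonal[where P = P and w = w, OF _ ij]) (use uni in auto)
    then have "g i j \<le> a"
      using bound[OF \<nu>(1)] by (simp add: g_def m_def)
    moreover have "g i j + m \<ge> 0" by (simp add: g_def)
    ultimately show ?thesis by (simp add: mult_le_0_iff)
  qed
  have sum_g: "0 \<le> (\<Sum>i<Suc N. \<Sum>j<Suc N. g i j)"
  proof -
    have "complex_of_real (\<Sum>i<Suc N. \<Sum>j<Suc N. g i j)
        = (\<Sum>i<Suc N. \<Sum>j<Suc N. power_gram quot D i j)"
      by (simp only: of_real_sum g_gram)
    also have "\<dots> = of_real (\<Sum>x\<in>D. (cmod (\<Sum>i<Suc N. quot x ^ i))\<^sup>2)"
      by (rule sum_power_gram)
    finally have "(\<Sum>i<Suc N. \<Sum>j<Suc N. g i j) = (\<Sum>x\<in>D. (cmod (\<Sum>i<Suc N. quot x ^ i))\<^sup>2)"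
      by (simp only: of_real_eq_iff)
    then show ?thesis by (simp add: sum_nonneg del: sum.lessThan_Suc)
  qed
  have sum_g2: "(m\<^sup>2 - m) * L\<^sup>2 \<le> (\<Sum>i<Suc N. \<Sum>j<Suc N. (g i j)\<^sup>2)"
  proof -
    have "cmod (quot x) = 1" if "x \<in> D" for x
      using that uni by (auto simp: D_def quot_def norm_mult)
    then have "real (card D) * (real (Suc N))\<^sup>2
        \<le> (\<Sum>i<Suc N. \<Sum>j<Suc N. (cmod (power_gram quot D i j))\<^sup>2)"
      using fin by (intro sum_norm_power_gram_square_ge) (auto simp: D_def)
    moreover have "(cmod (power_gram quot D i j))\<^sup>2 = (g i j)\<^sup>2" for i j
      by (simp only: g_gram[symmetric] norm_of_real power2_abs)
    ultimately show ?thesis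
      using card_off_diagonal[OF fin] by (simp only: L_eq D_def m_def)
  qed
  have upper: "(\<Sum>i<Suc N. \<Sum>j<Suc N. (g i j - a) * (g i j + m)) \<le> L * ((m\<^sup>2 - m - a) * m\<^sup>2)"
  proof -
    have "(\<Sum>i<Suc N. \<Sum>j<Suc N. (g i j - a) * (g i j + m))
        \<le> (\<Sum>i<Suc N. \<Sum>j<Suc N. if i = j then (m\<^sup>2 - m - a) * m\<^sup>2 else 0)"
    proof (intro sum_mono)
      fix i j assume "i \<in> {..<Suc N}" "j \<in> {..<Suc N}"
      then show "(g i j - a) * (g i j + m) \<le> (if i = j then (m\<^sup>2 - m - a) * m\<^sup>2 else 0)"
        using g_off[of i j] by (auto simp: g_diag)
    qed
    also have "\<dots> = L * ((m\<^sup>2 - m - a) * m\<^sup>2)"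
      by (simp add: L_eq del: sum.lessThan_Suc)
    finally show ?thesis .
  qed
  have expand: "(\<Sum>i<Suc N. \<Sum>j<Suc N. (g i j - a) * (g i j + m))
      = (\<Sum>i<Suc N. \<Sum>j<Suc N. (g i j)\<^sup>2) + (m - a) * (\<Sum>i<Suc N. \<Sum>j<Suc N. g i j) - a * m * L\<^sup>2"
  proof -
    have "(g i j - a) * (g i j + m) = (g i j)\<^sup>2 + (m - a) * g i j - a * m" for i j
      by (simp add: power2_eq_square algebra_simps)
    then show ?thesis
      by (simp add: sum.distrib sum_subtractf sum_distrib_left L_eq power2_eq_square
          del: sum.lessThan_Suc)
  qed
  have "0 \<le> (m - a) * (\<Sum>i<Suc N. \<Sum>j<Suc N. g i j)"
    using a sum_g by (intro mult_nonneg_nonneg) (simp_all only: diff_ge_0_iff_ge)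
  then have "(m\<^sup>2 - m) * L\<^sup>2 - a * m * L\<^sup>2 \<le> L * ((m\<^sup>2 - m - a) * m\<^sup>2)"
    using upper expand sum_g2 by linarith
  \<comment> \<open>Both sides are divisible by \<open>m * L\<close>; collecting the terms with \<open>a\<close> turns the factor \<open>L\<close>
    of \<open>a\<close> into \<open>L - m\<close>, owing to the value \<open>- a\<close> in the diagonal entries on the right.\<close>
  then have "(m * L) * ((m - 1) * (L - m\<^sup>2)) \<le> (m * L) * (a * (L - m))"
    by (simp add: power2_eq_square algebra_simps)
  then have "(m - 1) * (L - m\<^sup>2) \<le> a * (L - m)"
    using m_pos L_pos by (simp add: mult_le_cancel_left_pos)
  then show ?thesis by (simp add: L_def)
qed

section \<open>The lower bound for the maximum\<close>

theorem theorem4: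
  fixes n j :: nat and z :: "nat \<Rightarrow> complex"
  assumes "n \<ge> 1"
    and "\<And>k. k \<in> {1..n} \<Longrightarrow> cmod (z k) = 1"
  shows "(MAX \<nu>\<in>{1..n^2 + j}. cmod (\<Sum>k=1..n. z k ^ \<nu>))
    \<ge> sqrt (real n + ((1 + real j) * (real n - 1)) / (2 * (real j + (real n)^2)))"
proof -
  define N where "N = n^2 + j"
  define M where "M = (MAX \<nu>\<in>{1..N}. cmod (\<Sum>k=1..n. z k ^ \<nu>))"
  define a where "a = M\<^sup>2 - real n"
  define t where "t = ((1 + real j) * (real n - 1)) / (2 * (real j + (real n)^2))"
  have N1: "1 \<le> N" using one_le_power[OF assms(1), of 2] unfolding N_def by linarith
  have nN: "real N = (real n)\<^sup>2 + real j" by (simp add: N_def)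
  have n1: "1 \<le> real n" using assms(1) by simp
  then have n_le: "real n \<le> (real n)\<^sup>2" by (simp add: power2_eq_square)
  have M_ge: "cmod (\<Sum>k=1..n. z k ^ \<nu>) \<le> M" if "\<nu> \<in> {1..N}" for \<nu>
    unfolding M_def using that by (intro Max_ge) auto
  have M0: "0 \<le> M" using M_ge[of 1] N1 order_trans[OF norm_ge_zero] by auto
  have den: "0 < 2 * real N" using N1 by simp
  have t_eq: "t = ((1 + real j) * (real n - 1)) / (2 * real N)"
    by (simp add: t_def nN add.commute)
  have "t \<le> a"
  proof (cases "a \<le> real n")
    case True
    have "(real n - 1) * (real N + 1 - (real n)\<^sup>2) \<le> a * (real N + 1 - real n)"
    proof (rule power_sum_square_bound[of "{1..n}" z N a, simplified card_atLeastAtMost diff_Suc_1])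
      show "(cmod (\<Sum>k=1..n. z k ^ \<nu>))\<^sup>2 \<le> real n + a" if "\<nu> \<in> {1..N}" for \<nu>
        using power_mono[OF M_ge[OF that], of 2] by (simp add: a_def)
    qed (use assms True in auto)
    then have key: "(1 + real j) * (real n - 1) \<le> a * (real N + 1 - real n)"
      by (simp add: nN mult.commute add.commute)
    have pos: "0 < real N + 1 - real n" using n_le nN by linarith
    have "0 \<le> a * (real N + 1 - real n)"
      using key n1 by (intro order_trans[OF _ key]) simp
    then have "0 \<le> a" using pos by (simp add: zero_le_mult_iff)
    then have "a * (real N + 1 - real n) \<le> a * (2 * real N)"
      using N1 n1 by (intro mult_left_mono) auto
    then show ?thesis
      unfolding t_eq using key den by (simp add: pos_divide_le_eq)
  next
    case False
    have "1 + real j \<le> 2 * real N"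
    proof -
      have "1 + x \<le> 2 * (y + x)" if "1 \<le> y" "0 \<le> x" for x y :: real
        using that by simp
      then show ?thesis
        unfolding nN using order_trans[OF n1 n_le] of_nat_0_le_iff by blast
    qed
    then have "(1 + real j) * (real n - 1) \<le> 2 * real N * (real n - 1)"
      using n1 by (intro mult_right_mono) auto
    also have "\<dots> \<le> real n * (2 * real N)"
      using den by (simp add: algebra_simps)
    finally have "t \<le> real n"
      unfolding t_eq using den by (simp add: pos_divide_le_eq)
    then show ?thesis using False by simp
  qed
  then have "real n + t \<le> M\<^sup>2" by (simp add: a_def)
  then have "sqrt (real n + t) \<le> M" using M0 by (rule real_le_lsqrt[rotated 1])
  then show ?thesis by (simp only: t_def M_def N_def)
qed

end
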